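(* Let $\mathscr{H}$ be a complex Hilbert space and let $A\in\mathbb{B}(\mathscr{H})$. Then $$\frac{1}{4}\|A^*A+AA^*\|\leq\frac{1}{2\sqrt{2}}\left(\|\Re(A)+\Im(A)\|^4+\|\Re(A)-\Im(A)\|^4\right)^{\frac{1}{2}}\leq w^2(A).$$
   Context: $\mathbb{B}(\mathscr{H})$ is the algebra of all bounded linear operators on the complex Hilbert space $\mathscr{H}$, and $\|\cdot\|$ is the operator norm. $\Re(A)=\frac{1}{2}(A+A^* )$ and $\Im(A)=\frac{1}{2\mathrm{i}}(A-A^* )$ (both are self-adjoint operators). The numerical radius is $w(A)=\sup\{|\langle Ax,x\rangle|: x\in\mathscr{H},\ \|x\|=1\}$, and $w^2(A)$ means $(w(A))^2$. *)

theory Defs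
  imports "HOL-Analysis.Analysis"
begin

text \<open>
  Complex inner product spaces as a type class over the library's normed spaces. The inner product
  is linear in its first argument. The triangle inequality is inherited as an axiom
  from \<^class>\<open>real_normed_vector\<close>; it is redundant, since the norm is the one induced by
  the inner product.
\<close>

class complex_inner = real_normed_vector +
  fixes scaleC :: "complex \<Rightarrow> 'a \<Rightarrow> 'a" (infixr "*\<^sub>C" 75)
    and cinner :: "'a \<Rightarrow> 'a \<Rightarrow> complex"
  assumes scaleC_add_right: "c *\<^sub>C (x + y) = c *\<^sub>C x + c *\<^sub>C y"
    and scaleC_add_left: "(c + d) *\<^sub>C x = c *\<^sub>C x + d *\<^sub>C x"
    and scaleC_scaleC: "c *\<^sub>C (d *\<^sub>C x) = (c * d) *\<^sub>C x"
    and scaleR_scaleC: "r *\<^sub>R x = complex_of_real r *\<^sub>C x"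
    and cinner_commute: "cinner x y = cnj (cinner y x)"
    and cinner_add_left: "cinner (x + y) z = cinner x z + cinner y z"
    and cinner_scaleC_left: "cinner (c *\<^sub>C x) y = c * cinner x y"
    and cinner_ge_zero: "0 \<le> Re (cinner x x)"
    and cinner_eq_zero_iff: "cinner x x = 0 \<longleftrightarrow> x = 0"
    and norm_eq_sqrt_cinner: "norm x = sqrt (Re (cinner x x))"

class chilbert_space = complex_inner + complete_space

instantiation complex :: chilbert_space
begin

definition scaleC_complex :: "complex \<Rightarrow> complex \<Rightarrow> complex"
  where "scaleC_complex c x = c * x"

definition cinner_complex :: "complex \<Rightarrow> complex \<Rightarrow> complex"
  where "cinner_complex x y = x * cnj y"

instance
proof
  fix x y z c d :: complex and r :: real
  show "c *\<^sub>C (x + y) = c *\<^sub>C x + c *\<^sub>C y" "(c + d) *\<^sub>C x = c *\<^sub>C x + d *\<^sub>C x"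
    "c *\<^sub>C (d *\<^sub>C x) = (c * d) *\<^sub>C x"
    by (simp_all only: scaleC_complex_def distrib_left distrib_right mult.assoc)
  show "r *\<^sub>R x = complex_of_real r *\<^sub>C x"
    by (simp only: scaleC_complex_def scaleR_conv_of_real)
  show "cinner x y = cnj (cinner y x)" "cinner (x + y) z = cinner x z + cinner y z"
    "cinner x x = 0 \<longleftrightarrow> x = 0"
    by (simp_all add: cinner_complex_def distrib_right)
  show "cinner (c *\<^sub>C x) y = c * cinner x y"
    by (simp only: cinner_complex_def scaleC_complex_def mult.assoc)
  show "0 \<le> Re (cinner x x)" "norm x = sqrt (Re (cinner x x))"
    by (simp_all add: cinner_complex_def cmod_def power2_eq_square)
qed

end

definition bounded_clinear :: "('a::complex_inner \<Rightarrow> 'a) \<Rightarrow> bool"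
  where "bounded_clinear A \<longleftrightarrow> bounded_linear A \<and> (\<forall>c x. A (c *\<^sub>C x) = c *\<^sub>C A x)"

text \<open>
  On a Hilbert space every bounded operator has exactly one adjoint, by the Riesz
  representation theorem, so the description below denotes it.
\<close>

definition cadjoint :: "('a::complex_inner \<Rightarrow> 'a) \<Rightarrow> 'a \<Rightarrow> 'a"
  where "cadjoint A = (THE B. \<forall>x y. cinner (A x) y = cinner x (B y))"

lemma cinner_eqI:
  fixes u v :: "'a::complex_inner"
  assumes "\<And>x. cinner x u = cinner x v"
  shows "u = v"
proof -
  have eq: "cinner u x = cinner v x" for x
    using assms[of x] cinner_commute[of u x] cinner_commute[of v x] by simp
  have "cinner (u - v) (u - v) + cinner v (u - v) = cinner u (u - v)"
    using cinner_add_left[of "u - v" v "u - v"] by simp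
  then have "cinner (u - v) (u - v) = 0" by (simp add: eq)
  then show ?thesis by (simp add: cinner_eq_zero_iff)
qed

lemma cadjoint_eqI:
  assumes "\<And>x y. cinner (A x) y = cinner x (B y)"
  shows "cadjoint A = B"
  unfolding cadjoint_def
proof (rule the_equality)
  fix C assume "\<forall>x y. cinner (A x) y = cinner x (C y)"
  with assms have "cinner x (C y) = cinner x (B y)" for x y by metis
  then have "C y = B y" for y by (rule cinner_eqI)
  then show "C = B" by (rule ext)
qed (use assms in blast)

definition Re_op :: "('a::complex_inner \<Rightarrow> 'a) \<Rightarrow> 'a \<Rightarrow> 'a"
  where "Re_op A = (\<lambda>x. (1 / 2) *\<^sub>C (A x + cadjoint A x))"

definition Im_op :: "('a::complex_inner \<Rightarrow> 'a) \<Rightarrow> 'a \<Rightarrow> 'a"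
  where "Im_op A = (\<lambda>x. (1 / (2 * \<i>)) *\<^sub>C (A x - cadjoint A x))"

definition numerical_radius :: "('a::complex_inner \<Rightarrow> 'a) \<Rightarrow> real"
  where "numerical_radius A = Sup {cmod (cinner (A x) x) | x. norm x = 1}"

end

theory Submission
  imports Defs
begin

text \<open>
  Put \<open>S = \<Re>(A) + \<Im>(A)\<close> and \<open>D = \<Re>(A) - \<Im>(A)\<close>. Both are self-adjoint, and the cross terms
  cancel in \<open>S\<^sup>2 + D\<^sup>2 = 2 (\<Re>(A)\<^sup>2 + \<Im>(A)\<^sup>2) = A\<^sup>*A + AA\<^sup>*\<close>. Hence
  \<open>\<parallel>A\<^sup>*A + AA\<^sup>*\<parallel> \<le> \<parallel>S\<parallel>\<^sup>2 + \<parallel>D\<parallel>\<^sup>2\<close>, and the first inequality is the comparison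
  \<open>p + q \<le> \<surd>2 \<surd>(p\<^sup>2 + q\<^sup>2)\<close> of the 1-norm with the 2-norm in the plane, at
  \<open>p = \<parallel>S\<parallel>\<^sup>2\<close> and \<open>q = \<parallel>D\<parallel>\<^sup>2\<close>.

  For the second inequality write \<open>\<langle>Ax, x\<rangle> = a + ib\<close> with \<open>a\<close>, \<open>b\<close> real. Then
  \<open>\<langle>Sx, x\<rangle> = a + b\<close> and \<open>\<langle>Dx, x\<rangle> = a - b\<close>, both of modulus at most \<open>\<surd>2 \<bar>a + ib\<bar>\<close>. The norm of a
  self-adjoint operator is governed by its quadratic form (\<open>norm_le_of_quadratic_form\<close>), so
  \<open>\<parallel>S\<parallel>\<close> and \<open>\<parallel>D\<parallel>\<close> are at most \<open>\<surd>2 w(A)\<close>, which gives exactly \<open>w(A)\<^sup>2\<close> as the bound of the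
  middle term.

  All of this presupposes that the adjoint exists. It is obtained from the Riesz representation
  theorem (\<open>riesz_representation\<close>), where the representing vector of a functional \<open>f\<close> is found as
  the minimiser of \<open>\<parallel>x\<parallel>\<^sup>2 - 2 Re (f x)\<close>.
\<close>

section \<open>Complex inner product spaces\<close>

lemma cinner_add_right: "cinner x (y + z) = cinner x y + cinner x z"
  for x y z :: "'a::complex_inner"
  by (metis cinner_add_left cinner_commute complex_cnj_add)

lemma cinner_scaleC_right: "cinner x (c *\<^sub>C y) = cnj c * cinner x y"
  for x y :: "'a::complex_inner"
  by (metis cinner_commute cinner_scaleC_left complex_cnj_mult)

lemma scaleC_minus_one: "- x = (- 1) *\<^sub>C x"
  for x :: "'a::complex_inner"
  using scaleR_scaleC[of "- 1" x] by simp

lemma cinner_minus_left: "cinner (- x) y = - cinner x y"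
  for x y :: "'a::complex_inner"
  by (simp only: scaleC_minus_one[of x] cinner_scaleC_left) simp

lemma cinner_minus_right: "cinner x (- y) = - cinner x y"
  for x y :: "'a::complex_inner"
  by (simp only: scaleC_minus_one[of y] cinner_scaleC_right) simp

lemma cinner_diff_left: "cinner (x - y) z = cinner x z - cinner y z"
  for x y z :: "'a::complex_inner"
  using cinner_add_left[of x "- y" z] by (simp add: cinner_minus_left)

lemma cinner_diff_right: "cinner x (y - z) = cinner x y - cinner x z"
  for x y z :: "'a::complex_inner"
  using cinner_add_right[of x y "- z"] by (simp add: cinner_minus_right)

lemmas cinner_linear =
  cinner_add_left cinner_add_right cinner_diff_left cinner_diff_right
  cinner_scaleC_left cinner_scaleC_right

lemma Re_cinner_commute: "Re (cinner x y) = Re (cinner y x)"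
  for x y :: "'a::complex_inner"
  by (metis cinner_commute complex_cnj(1) complex_surj complex.sel(1))

lemma Re_cinner_self: "Re (cinner x x) = (norm x)\<^sup>2"
  for x :: "'a::complex_inner"
  by (simp add: norm_eq_sqrt_cinner cinner_ge_zero)

lemma norm_add_square: "(norm (x + y))\<^sup>2 = (norm x)\<^sup>2 + 2 * Re (cinner x y) + (norm y)\<^sup>2"
  for x y :: "'a::complex_inner"
  using Re_cinner_commute[of y x] by (simp flip: Re_cinner_self add: cinner_linear)

lemma norm_diff_square: "(norm (x - y))\<^sup>2 = (norm x)\<^sup>2 - 2 * Re (cinner x y) + (norm y)\<^sup>2"
  for x y :: "'a::complex_inner"
  using Re_cinner_commute[of y x] by (simp flip: Re_cinner_self add: cinner_linear)

lemma norm_scaleC: "norm (c *\<^sub>C x) = cmod c * norm x"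
  for x :: "'a::complex_inner"
proof -
  have "cinner (c *\<^sub>C x) (c *\<^sub>C x) = (c * cnj c) * cinner x x"
    by (simp add: cinner_linear)
  also have "\<dots> = of_real ((cmod c)\<^sup>2) * cinner x x"
    by (simp only: complex_norm_square)
  finally have "cinner (c *\<^sub>C x) (c *\<^sub>C x) = of_real ((cmod c)\<^sup>2) * cinner x x" .
  then have "(norm (c *\<^sub>C x))\<^sup>2 = (cmod c * norm x)\<^sup>2"
    by (simp flip: Re_cinner_self add: power_mult_distrib)
  then show ?thesis by simp
qed

text \<open>The triangle inequality, squared, is the real part of the Cauchy--Schwarz inequality; rotating
  \<open>x\<close> by a phase that makes \<open>\<langle>x, y\<rangle>\<close> real and nonnegative gives the modulus.\<close>

lemma Re_cinner_le: "Re (cinner x y) \<le> norm x * norm y"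
  for x y :: "'a::complex_inner"
proof -
  have "(norm (x + y))\<^sup>2 \<le> (norm x + norm y)\<^sup>2"
    by (simp add: norm_triangle_ineq power_mono)
  then show ?thesis by (simp add: norm_add_square power2_sum)
qed

lemma cmod_cinner_le: "cmod (cinner x y) \<le> norm x * norm y"
  for x y :: "'a::complex_inner"
proof (cases "cinner x y = 0")
  case False
  define c where "c = cnj (cinner x y) / of_real (cmod (cinner x y))"
  have "cmod c = 1" using False by (simp add: c_def norm_divide)
  have "c * cinner x y = of_real (cmod (cinner x y))"
    using False
    by (simp add: c_def field_simps complex_norm_square[symmetric] power2_eq_square flip: of_real_mult)
  then have "cmod (cinner x y) = Re (cinner (c *\<^sub>C x) y)"
    by (simp add: cinner_linear)
  also have "\<dots> \<le> norm x * norm y"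
    using Re_cinner_le[of "c *\<^sub>C x" y] \<open>cmod c = 1\<close> by (simp add: norm_scaleC)
  finally show ?thesis .
qed simp

section \<open>The Riesz representation theorem and the adjoint\<close>

text \<open>
  The functional \<open>q x = \<parallel>x\<parallel>\<^sup>2 - 2 Re (f x)\<close> equals \<open>\<parallel>x - z\<parallel>\<^sup>2 - \<parallel>z\<parallel>\<^sup>2\<close> once \<open>f\<close> is represented by \<open>z\<close>,
  so \<open>z\<close> has to be its minimiser. A minimiser exists because the parallelogram law makes every
  minimising sequence Cauchy, and it represents \<open>f\<close> because the first variation of \<open>q\<close> at a
  minimiser vanishes.
\<close>

theorem riesz_representation:
  fixes f :: "'a::chilbert_space \<Rightarrow> complex"
  assumes f_add: "\<And>x y. f (x + y) = f x + f y"
    and f_scale: "\<And>c x. f (c *\<^sub>C x) = c * f x"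
    and f_bound: "\<And>x. cmod (f x) \<le> K * norm x"
  shows "\<exists>z. \<forall>x. f x = cinner x z"
proof -
  define g where "g x = Re (f x)" for x
  define q where "q x = (norm x)\<^sup>2 - 2 * g x" for x
  have g_add: "g (x + y) = g x + g y" for x y by (simp add: g_def f_add)
  have g_scale: "g (r *\<^sub>R x) = r * g x" for r x by (simp add: g_def f_scale scaleR_scaleC)
  have g_bound: "\<bar>g x\<bar> \<le> K * norm x" for x
    unfolding g_def using abs_Re_le_cmod f_bound by (rule order_trans)
  have g_lin: "bounded_linear g"
    by (rule bounded_linear_intro[where K = K])
      (use g_add g_scale g_bound in \<open>simp_all add: mult.commute\<close>)
  have q_lower: "- K\<^sup>2 \<le> q x" for x
    using g_bound[of x] sum_squares_bound[of K "norm x"] by (simp add: q_def abs_le_iff)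
  define m where "m = Inf (range q)"
  have bdd: "bdd_below (range q)" using q_lower by (auto intro!: bdd_belowI)
  have m_le: "m \<le> q x" for x unfolding m_def using bdd by (auto intro: cInf_lower)
  have "\<exists>x. q x < m + 1 / real (Suc n)" for n
  proof -
    have "Inf (range q) < m + 1 / real (Suc n)" by (simp add: m_def)
    then show ?thesis using cInf_lessD[of "range q" "m + 1 / real (Suc n)"] by auto
  qed
  then obtain u where u: "\<And>n. q (u n) < m + 1 / real (Suc n)" by metis
  have dist_sq: "(norm (x - y))\<^sup>2 = 2 * q x + 2 * q y - 4 * q ((1 / 2) *\<^sub>R (x + y))" for x y
  proof -
    have "(norm ((1 / 2) *\<^sub>R (x + y)))\<^sup>2 = (norm (x + y))\<^sup>2 / 4"
      by (simp only: norm_scaleR) (simp add: power_divide)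
    then show ?thesis
      using norm_add_square[of x y]
      by (simp only: q_def g_scale g_add norm_diff_square) (simp add: field_simps)
  qed
  have near: "(norm (u i - u j))\<^sup>2 \<le> 2 / real (Suc i) + 2 / real (Suc j)" for i j
    using dist_sq[of "u i" "u j"] u[of i] u[of j] m_le[of "(1 / 2) *\<^sub>R (u i + u j)"] by simp
  have "Cauchy u"
  proof (rule CauchyI)
    fix e :: real assume "0 < e"
    then obtain N where N: "1 / real (Suc N) < e\<^sup>2 / 4"
      using nat_approx_posE[of "e\<^sup>2 / 4"] by auto
    have "norm (u i - u j) < e" if "i \<ge> N" "j \<ge> N" for i j
    proof -
      have "1 / real (Suc i) \<le> 1 / real (Suc N)" "1 / real (Suc j) \<le> 1 / real (Suc N)"
        using that by (simp_all add: frac_le)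
      then have "(norm (u i - u j))\<^sup>2 < e\<^sup>2" using near[of i j] N by simp
      then show ?thesis using \<open>0 < e\<close> by (simp add: power_less_imp_less_base)
    qed
    then show "\<exists>M. \<forall>i\<ge>M. \<forall>j\<ge>M. norm (u i - u j) < e" by blast
  qed
  then obtain z where z: "u \<longlonglongrightarrow> z" using Cauchy_convergent convergent_def by blast
  have "(\<lambda>n. q (u n)) \<longlonglongrightarrow> q z"
    unfolding q_def by (intro tendsto_intros bounded_linear.tendsto[OF g_lin] z)
  moreover have "(\<lambda>n. m + 1 / real (Suc n)) \<longlonglongrightarrow> m + 0"
    by (intro tendsto_intros LIMSEQ_Suc[OF lim_1_over_n])
  ultimately have "q z \<le> m + 0"
    by (rule LIMSEQ_le) (use u in \<open>auto intro: less_imp_le\<close>)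
  then have z_min: "q z \<le> q x" for x using m_le[of x] by simp
  have g_eq: "g v = Re (cinner v z)" for v
  proof -
    define a where "a = Re (cinner v z) - g v"
    define N where "N = (norm v)\<^sup>2 + 1"
    have "N > 0" by (simp add: N_def add_nonneg_pos)
    have expand: "q (z + t *\<^sub>R v) = q z + 2 * t * a + t\<^sup>2 * (norm v)\<^sup>2" for t
      using Re_cinner_commute[of z v]
      by (simp add: q_def a_def norm_add_square g_add g_scale[unfolded scaleR_scaleC] scaleR_scaleC norm_scaleC
          cinner_linear power_mult_distrib algebra_simps)
    \<comment> \<open>The step \<open>- a / \<parallel>v\<parallel>\<^sup>2\<close> would be optimal; adding 1 to the denominator also covers \<open>v = 0\<close>.\<close>
    have "0 \<le> 2 * (- a / N) * a + (- a / N)\<^sup>2 * (N - 1)"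
      using z_min[of "z + (- a / N) *\<^sub>R v"] unfolding expand by (simp add: N_def)
    also have "\<dots> = - (a\<^sup>2 * (N + 1)) / N\<^sup>2"
      using \<open>N > 0\<close> by (simp add: field_simps power2_eq_square)
    finally have "a\<^sup>2 * (N + 1) \<le> 0" using \<open>N > 0\<close> by (simp add: divide_le_0_iff zero_le_divide_iff)
    then have "a = 0" using \<open>N > 0\<close> by (simp add: mult_le_0_iff)
    then show ?thesis by (simp add: a_def)
  qed
  \<comment> \<open>Complex linearity recovers the imaginary part: \<open>Im w = Re (- \<i> w)\<close>.\<close>
  have "f x = cinner x z" for x
    using g_eq[of x] g_eq[of "(- \<i>) *\<^sub>C x"]
    by (simp add: complex_eq_iff g_def f_scale cinner_linear)
  then show ?thesis by blast
qed

lemma cadjoint_works: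
  fixes A :: "'a::chilbert_space \<Rightarrow> 'a"
  assumes "bounded_clinear A"
  shows "cinner (A x) y = cinner x (cadjoint A y)"
proof -
  have lin: "bounded_linear A" and scale: "\<And>c x. A (c *\<^sub>C x) = c *\<^sub>C A x"
    using assms by (auto simp: bounded_clinear_def)
  have "\<exists>z. \<forall>x. cinner (A x) y = cinner x z" for y
  proof (rule riesz_representation[where K = "onorm A * norm y"])
    show "cmod (cinner (A x) y) \<le> onorm A * norm y * norm x" for x
      using cmod_cinner_le[of "A x" y] mult_right_mono[OF onorm[OF lin, of x], of "norm y"]
      by (simp add: mult_ac)
  qed (simp_all add: linear_add[OF bounded_linear.linear[OF lin]] scale cinner_linear)
  then obtain B where B: "\<And>x y. cinner (A x) y = cinner x (B y)" by metis
  then show ?thesis using cadjoint_eqI[of A B] by simp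
qed

lemma bounded_clinear_cadjoint:
  fixes A :: "'a::chilbert_space \<Rightarrow> 'a"
  assumes A: "bounded_clinear A"
  shows "bounded_clinear (cadjoint A)"
proof -
  have lin: "bounded_linear A" using A by (simp add: bounded_clinear_def)
  have scale: "cadjoint A (c *\<^sub>C x) = c *\<^sub>C cadjoint A x" for c x
    by (rule cinner_eqI) (simp add: cadjoint_works[OF A, symmetric] cinner_linear)
  have "bounded_linear (cadjoint A)"
  proof (rule bounded_linear_intro[where K = "onorm A"])
    show "cadjoint A (x + y) = cadjoint A x + cadjoint A y" for x y
      by (rule cinner_eqI) (simp add: cadjoint_works[OF A, symmetric] cinner_linear)
    show "cadjoint A (r *\<^sub>R x) = r *\<^sub>R cadjoint A x" for r x
      by (simp add: scaleR_scaleC scale)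
    show "norm (cadjoint A y) \<le> norm y * onorm A" for y
    proof (cases "cadjoint A y = 0")
      case True
      then show ?thesis by (simp add: onorm_pos_le[OF lin])
    next
      case False
      let ?z = "cadjoint A y"
      have "norm ?z * norm ?z = Re (cinner (A ?z) y)"
        by (simp add: cadjoint_works[OF A] Re_cinner_self power2_eq_square)
      also have "\<dots> \<le> norm (A ?z) * norm y" by (rule Re_cinner_le)
      also have "\<dots> \<le> (onorm A * norm ?z) * norm y"
        by (rule mult_right_mono[OF onorm[OF lin]]) simp
      finally show ?thesis using False by (simp add: mult_ac)
    qed
  qed
  then show ?thesis using scale by (simp add: bounded_clinear_def)
qed

section \<open>Quadratic forms and the numerical radius\<close>

text \<open>
  Polarisation: \<open>4 Re \<langle>Sx, y\<rangle> = \<langle>S(x+y), x+y\<rangle> - \<langle>S(x-y), x-y\<rangle>\<close> for self-adjoint \<open>S\<close>, and by the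
  parallelogram law the right-hand side is at most \<open>2M(\<parallel>x\<parallel>\<^sup>2 + \<parallel>y\<parallel>\<^sup>2)\<close>. Taking for \<open>y\<close> the vector in
  the direction of \<open>Sx\<close> with \<open>\<parallel>y\<parallel> = \<parallel>x\<parallel>\<close> turns this into \<open>\<parallel>Sx\<parallel> \<le> M\<parallel>x\<parallel>\<close>.
\<close>

lemma norm_le_of_quadratic_form:
  fixes S :: "'a::complex_inner \<Rightarrow> 'a"
  assumes S: "bounded_linear S"
    and selfadjoint: "\<And>x y. cinner (S x) y = cinner x (S y)"
    and form: "\<And>x. \<bar>Re (cinner (S x) x)\<bar> \<le> M * (norm x)\<^sup>2"
  shows "norm (S x) \<le> M * norm x"
proof (cases "x = 0 \<or> S x = 0")
  case True
  have "0 \<le> M" if "x \<noteq> 0"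
    using order_trans[OF abs_ge_zero form[of x]] that by (simp add: zero_le_mult_iff)
  then show ?thesis using True linear_0[OF bounded_linear.linear[OF S]] by (cases "x = 0") auto
next
  case False
  note lin = bounded_linear.linear[OF S]
  have polar: "4 * Re (cinner (S x) y) \<le> 2 * M * ((norm x)\<^sup>2 + (norm y)\<^sup>2)" for y
  proof -
    have "Re (cinner (S y) x) = Re (cinner (S x) y)"
      using selfadjoint[of y x] Re_cinner_commute[of y "S x"] by simp
    then have "4 * Re (cinner (S x) y)
        = Re (cinner (S (x + y)) (x + y)) - Re (cinner (S (x - y)) (x - y))"
      by (simp add: linear_add[OF lin] linear_diff[OF lin] cinner_linear)
    also have "\<dots> \<le> M * (norm (x + y))\<^sup>2 + M * (norm (x - y))\<^sup>2"
      using form[of "x + y"] form[of "x - y"] by (simp add: abs_le_iff)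
    also have "\<dots> = 2 * M * ((norm x)\<^sup>2 + (norm y)\<^sup>2)"
      by (simp add: norm_add_square norm_diff_square algebra_simps)
    finally show ?thesis .
  qed
  define r where "r = norm x / norm (S x)"
  have "4 * (r * (norm (S x))\<^sup>2) \<le> 2 * M * ((norm x)\<^sup>2 + (norm (r *\<^sub>R S x))\<^sup>2)"
    using polar[of "r *\<^sub>R S x"] by (simp add: scaleR_scaleC cinner_linear Re_cinner_self)
  moreover have "r * (norm (S x))\<^sup>2 = norm (S x) * norm x" "norm (r *\<^sub>R S x) = norm x"
    using False by (simp_all add: r_def power2_eq_square)
  ultimately have "4 * (norm (S x) * norm x) \<le> 2 * M * ((norm x)\<^sup>2 + (norm x)\<^sup>2)"
    by (simp only:)
  then have "norm (S x) * norm x \<le> (M * norm x) * norm x"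
    by (simp add: power2_eq_square)
  then show ?thesis using False by simp
qed

text \<open>On the zero space the supremum defining the numerical radius is taken over the empty set and
  its sign is unknown, hence the absolute value.\<close>

lemma cmod_cinner_le_numerical_radius:
  fixes A :: "'a::complex_inner \<Rightarrow> 'a"
  assumes A: "bounded_clinear A"
  shows "cmod (cinner (A x) x) \<le> \<bar>numerical_radius A\<bar> * (norm x)\<^sup>2"
proof (cases "x = 0")
  case True
  have "cinner (A 0) (0 :: 'a) = 0" using cmod_cinner_le[of "A 0" "0 :: 'a"] by simp
  then show ?thesis using True by simp
next
  case False
  have lin: "bounded_linear A" and scale: "\<And>c x. A (c *\<^sub>C x) = c *\<^sub>C A x"
    using A by (auto simp: bounded_clinear_def)
  define y where "y = of_real (1 / norm x) *\<^sub>C x"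
  have y: "norm y = 1" using False by (simp add: y_def norm_scaleC norm_divide)
  have "cmod (cinner (A v) v) \<le> onorm A" if "norm v = 1" for v
    using cmod_cinner_le[of "A v" v] onorm[OF lin, of v] that by simp
  then have "bdd_above {cmod (cinner (A x) x) | x. norm x = 1}"
    by (auto intro!: bdd_aboveI[where M = "onorm A"])
  then have "cmod (cinner (A y) y) \<le> numerical_radius A"
    unfolding numerical_radius_def by (rule cSup_upper[rotated]) (use y in blast)
  moreover have "cmod (cinner (A y) y) = cmod (cinner (A x) x) / (norm x)\<^sup>2"
    by (simp add: y_def scale cinner_linear norm_mult norm_divide power2_eq_square)
  ultimately have "cmod (cinner (A x) x) \<le> numerical_radius A * (norm x)\<^sup>2"
    using False by (simp add: field_simps)
  also have "\<dots> \<le> \<bar>numerical_radius A\<bar> * (norm x)\<^sup>2" by (simp add: mult_right_mono)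
  finally show ?thesis .
qed

lemma abs_Re_Im_le: "\<bar>Re c + Im c\<bar> \<le> sqrt 2 * cmod c" "\<bar>Re c - Im c\<bar> \<le> sqrt 2 * cmod c"
proof -
  have "(Re c + Im c)\<^sup>2 \<le> 2 * (cmod c)\<^sup>2" "(Re c - Im c)\<^sup>2 \<le> 2 * (cmod c)\<^sup>2"
    using sum_squares_bound[of "Re c" "Im c"] sum_squares_bound[of "Re c" "- Im c"]
    by (simp_all add: cmod_power2 power2_sum power2_diff)
  then show "\<bar>Re c + Im c\<bar> \<le> sqrt 2 * cmod c" "\<bar>Re c - Im c\<bar> \<le> sqrt 2 * cmod c"
    using real_sqrt_le_mono[of "(Re c + Im c)\<^sup>2"] real_sqrt_le_mono[of "(Re c - Im c)\<^sup>2"]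
    by (fastforce simp: real_sqrt_mult)+
qed

section \<open>The numerical radius inequalities\<close>

theorem theorem2p8:
  fixes A :: "'a::chilbert_space \<Rightarrow> 'a"
  assumes "bounded_clinear A"
  shows "1 / 4 * onorm (\<lambda>x. cadjoint A (A x) + A (cadjoint A x))
           \<le> 1 / (2 * sqrt 2) *
              sqrt (onorm (\<lambda>x. Re_op A x + Im_op A x) ^ 4 + onorm (\<lambda>x. Re_op A x - Im_op A x) ^ 4)
       \<and> 1 / (2 * sqrt 2) *
              sqrt (onorm (\<lambda>x. Re_op A x + Im_op A x) ^ 4 + onorm (\<lambda>x. Re_op A x - Im_op A x) ^ 4)
           \<le> (numerical_radius A)\<^sup>2"
proof -
  let ?B = "cadjoint A"
  define S where "S = (\<lambda>x. Re_op A x + Im_op A x)"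
  define D where "D = (\<lambda>x. Re_op A x - Im_op A x)"
  define w where "w = \<bar>numerical_radius A\<bar>"
  have B: "bounded_clinear ?B" by (rule bounded_clinear_cadjoint[OF assms])
  have linA: "bounded_linear A" and linB: "bounded_linear ?B"
    using assms B by (auto simp: bounded_clinear_def)
  have scaleA: "A (c *\<^sub>C x) = c *\<^sub>C A x" and scaleB: "?B (c *\<^sub>C x) = c *\<^sub>C ?B x" for c x
    using assms B by (auto simp: bounded_clinear_def)
  note addA = linear_add[OF bounded_linear.linear[OF linA]]
    and addB = linear_add[OF bounded_linear.linear[OF linB]]
    and diffA = linear_diff[OF bounded_linear.linear[OF linA]]
    and diffB = linear_diff[OF bounded_linear.linear[OF linB]]
  have adj: "cinner (A x) y = cinner x (?B y)" for x y
    by (rule cadjoint_works[OF assms])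
  have adj': "cinner (?B x) y = cinner x (A y)" for x y
    using adj[of y x] cinner_commute[of "?B x" y] cinner_commute[of x "A y"] by simp

  have bl_scaleC: "bounded_linear (\<lambda>x::'a. c *\<^sub>C x)" for c
    by (rule bounded_linear_intro[where K = "cmod c"])
      (simp_all add: scaleC_add_right scaleR_scaleC scaleC_scaleC norm_scaleC mult.commute)
  have linS: "bounded_linear S" and linD: "bounded_linear D"
    unfolding S_def D_def Re_op_def Im_op_def
    by (intro bounded_linear_add bounded_linear_sub linA linB
        bounded_linear_compose[OF bl_scaleC])+
  have S_self: "cinner (S x) y = cinner x (S y)" and D_self: "cinner (D x) y = cinner x (D y)"
    for x y
    by (simp_all add: S_def D_def Re_op_def Im_op_def cinner_linear adj adj' field_simps)
  have S_form: "Re (cinner (S x) x) = Re (cinner (A x) x) + Im (cinner (A x) x)"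
    and D_form: "Re (cinner (D x) x) = Re (cinner (A x) x) - Im (cinner (A x) x)" for x
  proof -
    have "cinner (?B x) x = cnj (cinner (A x) x)"
      using adj'[of x x] cinner_commute[of x "A x"] by simp
    then show "Re (cinner (S x) x) = Re (cinner (A x) x) + Im (cinner (A x) x)"
      "Re (cinner (D x) x) = Re (cinner (A x) x) - Im (cinner (A x) x)"
      by (simp_all add: S_def D_def Re_op_def Im_op_def cinner_linear)
  qed

  \<comment> \<open>Tested against an arbitrary vector, the operator identity becomes a scalar one.\<close>
  have squares: "?B (A x) + A (?B x) = S (S x) + D (D x)" for x
  proof (rule cinner_eqI)
    fix y
    show "cinner y (?B (A x) + A (?B x)) = cinner y (S (S x) + D (D x))"
      by (simp add: S_def D_def Re_op_def Im_op_def cinner_linear addA addB diffA diffB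
          scaleA scaleB field_simps)
  qed

  define s where "s = onorm S"
  define d where "d = onorm D"
  have "s \<ge> 0" "d \<ge> 0" by (simp_all add: s_def d_def onorm_pos_le linS linD)
  have SS: "norm (S x) \<le> s * norm x" and DD: "norm (D x) \<le> d * norm x" for x
    by (simp_all add: s_def d_def onorm linS linD)
  have "onorm (\<lambda>x. ?B (A x) + A (?B x)) \<le> s\<^sup>2 + d\<^sup>2"
  proof (rule onorm_bound)
    fix x
    have "norm (S (S x)) \<le> s * (s * norm x)" "norm (D (D x)) \<le> d * (d * norm x)"
      using SS[of "S x"] mult_left_mono[OF SS[of x] \<open>s \<ge> 0\<close>]
        DD[of "D x"] mult_left_mono[OF DD[of x] \<open>d \<ge> 0\<close>] by linarith+
    then show "norm (?B (A x) + A (?B x)) \<le> (s\<^sup>2 + d\<^sup>2) * norm x"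
      unfolding squares using norm_triangle_ineq[of "S (S x)" "D (D x)"]
      by (simp add: power2_eq_square algebra_simps)
  qed simp
  also have "s\<^sup>2 + d\<^sup>2 \<le> sqrt (2 * (s ^ 4 + d ^ 4))"
  proof (rule real_le_rsqrt)
    show "(s\<^sup>2 + d\<^sup>2)\<^sup>2 \<le> 2 * (s ^ 4 + d ^ 4)"
      using sum_squares_bound[of "s\<^sup>2" "d\<^sup>2"] by (simp add: power2_sum flip: power_mult)
  qed
  also have "\<dots> = sqrt 2 * sqrt (s ^ 4 + d ^ 4)" by (rule real_sqrt_mult)
  finally have "onorm (\<lambda>x. ?B (A x) + A (?B x)) \<le> sqrt 2 * sqrt (s ^ 4 + d ^ 4)" .
  moreover have "1 / (2 * sqrt 2) = sqrt 2 / 4" by (simp add: field_simps)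
  ultimately have first: "1 / 4 * onorm (\<lambda>x. ?B (A x) + A (?B x))
      \<le> 1 / (2 * sqrt 2) * sqrt (s ^ 4 + d ^ 4)"
    by (simp only:)

  have radius: "sqrt 2 * cmod (cinner (A x) x) \<le> sqrt 2 * w * (norm x)\<^sup>2" for x
    using cmod_cinner_le_numerical_radius[OF assms, of x] by (simp add: w_def mult.assoc)
  have "norm (S x) \<le> sqrt 2 * w * norm x" for x
    by (rule norm_le_of_quadratic_form[OF linS S_self])
      (unfold S_form, rule order_trans[OF abs_Re_Im_le(1) radius])
  then have s_le: "s \<le> sqrt 2 * w"
    unfolding s_def by (intro onorm_bound) (simp_all add: w_def)
  have "norm (D x) \<le> sqrt 2 * w * norm x" for x
    by (rule norm_le_of_quadratic_form[OF linD D_self])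
      (unfold D_form, rule order_trans[OF abs_Re_Im_le(2) radius])
  then have d_le: "d \<le> sqrt 2 * w"
    unfolding d_def by (intro onorm_bound) (simp_all add: w_def)
  have four: "(sqrt 2 * w) ^ 4 = 4 * w ^ 4"
    using power_mult[of "sqrt 2" 2 2] by (simp add: power_mult_distrib)
  have "s ^ 4 + d ^ 4 \<le> (2 * sqrt 2 * w\<^sup>2)\<^sup>2"
    using power_mono[OF s_le \<open>s \<ge> 0\<close>, of 4] power_mono[OF d_le \<open>d \<ge> 0\<close>, of 4]
    unfolding four by (simp add: power_mult_distrib flip: power_mult)
  then have "sqrt (s ^ 4 + d ^ 4) \<le> 2 * sqrt 2 * w\<^sup>2"
    by (rule real_le_lsqrt[rotated]) simp
  then have "1 / (2 * sqrt 2) * sqrt (s ^ 4 + d ^ 4) \<le> (numerical_radius A)\<^sup>2"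
    by (simp add: w_def field_simps)
  with first show ?thesis by (simp add: s_def d_def S_def D_def)
qed

end
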